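(* Let $\mathcal{L}$ be a quasi-definite linear functional and let $\mathcal{L}^G$ be its Geronimus transformation at $a\in\mathbb{R}$. Let $\{P_n(x)\}_{n=0}^\infty$ and $\{\mathcal{G}_n(x;a)\}_{n=0}^\infty$ be the sequences of monic orthogonal polynomials with respect to $\mathcal{L}$ and $\mathcal{L}^G$, respectively, and let $\mathcal{G}_n^Q(x;a)=\mathcal{G}_n(x;a)+\beta_n\mathcal{G}_{n-1}(x;a)$, with constants $\beta_n$, be the monic quasi-Geronimus polynomials of order one. Put $$l_n(x)=x-c_{n+1}+\chi_{n+1}(a)+\beta_{n+1},\qquad d_n(x)=\chi_n(a)+\beta_n+(x-c_n)\chi_{n-1}(a)\frac{\beta_n}{\lambda_n},$$ $$j_n(x)=l_n(x)d_n(x)-\bigl(c_{n+1}+\lambda_{n+1}-\chi_n(a)\beta_{n+1}\bigr)\left(\chi_{n-1}(a)\frac{\beta_n}{\lambda_n}-1\right),$$ $$m_{n+1}(x)=l_{n+1}(x)(x-c_{n+1})+\beta_{n+2}\chi_{n+1}(a)-\lambda_{n+2}.$$ Then the difference equation satisfied by the monic quasi-Geronimus polynomials of order one is $$j_n(x)\,\mathcal{G}_{n+2}^Q(x;a)=\left(d_n(x)m_{n+1}(x)-\lambda_{n+1}l_{n+1}(x)\left(\chi_{n-1}(a)\frac{\beta_n}{\lambda_n}-1\right)\right)\mathcal{G}_{n+1}^Q(x;a)$$ $$+\Bigl(m_{n+1}(x)\bigl(c_{n+1}+\lambda_{n+1}-\chi_n(a)\beta_{n+1}\bigr)-\lambda_{n+1}l_n(x)l_{n+1}(x)\Bigr)\mathcal{G}_n^Q(x;a),\qquad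 n\ge0.$$
   Context: A linear functional $\mathcal{L}$ on the polynomials with complex coefficients is quasi-definite if there is a sequence of monic polynomials $P_n$, $\deg P_n=n$, with $\mathcal{L}[P_nP_m]=0$ for $n\ne m$ and $\mathcal{L}[P_n^2]\ne0$. The numbers $c_n$ and $\lambda_n\neq0$ ($n\ge1$) are the coefficients of the recurrence $xP_n=P_{n+1}+c_{n+1}P_n+\lambda_{n+1}P_{n-1}$, $n\ge0$, with $P_0=1$, $P_{-1}=0$; $\lambda_1$ can be chosen arbitrarily. The Geronimus transformation of $\mathcal{L}$ at $a$ with constant $M$ is $\mathcal{L}^G[p(x)]=\mathcal{L}\left[\frac{p(x)-p(a)}{x-a}\right]+Mp(a)$. It is assumed quasi-definite. Its monic orthogonal polynomials (Geronimus polynomials) are $\mathcal{G}_n(x;a)=P_n(x)+\chi_n(a)P_{n-1}(x)$, $n\ge1$, where $$\chi_n(a)=-\frac{\mathcal{L}(1)Q_{n-1}(a)+MP_n(a)}{\mathcal{L}(1)Q_{n-2}(a)+MP_{n-1}(a)},\qquad n\ge1,$$ and the numerator (associated) polynomials are given by $\mathcal{L}(1)Q_{n-1}(a)=\mathcal{L}\left[\frac{P_n(x)-P_n(a)}{x-a}\right]$. The statement is given for $n\ge0$ without specifying values for quantities of index $\le0$ such as $c_0,\lambda_0,\chi_0(a),\chi_{-1}(a)$.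
   Formalization: The factor c_{n+1}+λ_{n+1}−χ_n(a)β_{n+1}, in j_n and in the coefficient of G_n^Q, is corrected to λ_{n+1}−χ_n(a)β_{n+1} (the printed equation fails, e.g. for Laguerre, a=−1, M=1, β=0, n=1); for n=0, where χ_{−1} is unspecified, χ_{−1}=0 or β_0=0 is assumed. *)

theory Defs
  imports Complex_Main "HOL-Computational_Algebra.Polynomial"
begin

definition linear_functional :: "(complex poly \<Rightarrow> complex) \<Rightarrow> bool" where
  "linear_functional L \<longleftrightarrow> Vector_Spaces.linear smult (*) L"

definition monic_ops :: "(complex poly \<Rightarrow> complex) \<Rightarrow> (nat \<Rightarrow> complex poly) \<Rightarrow> bool" where
  "monic_ops L P \<longleftrightarrow>
     (\<forall>n. degree (P n) = n \<and> lead_coeff (P n) = 1) \<and>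
     (\<forall>n m. n \<noteq> m \<longrightarrow> L (P n * P m) = 0) \<and>
     (\<forall>n. L ((P n)\<^sup>2) \<noteq> 0)"

definition quasi_definite :: "(complex poly \<Rightarrow> complex) \<Rightarrow> bool" where
  "quasi_definite L \<longleftrightarrow> linear_functional L \<and> (\<exists>P. monic_ops L P)"

(* The entry with index n - 1 of a polynomial sequence, where the entry with index -1 is 0. *)
definition prev :: "(nat \<Rightarrow> complex poly) \<Rightarrow> nat \<Rightarrow> complex poly" where
  "prev P n = (if n = 0 then 0 else P (n - 1))"

(* lam 1 multiplies P_{-1} = 0, so it is an arbitrary nonzero number; c 0 and lam 0 do not occur
   and are unconstrained. *)
definition recurrence_coeffs ::
  "(nat \<Rightarrow> complex poly) \<Rightarrow> (nat \<Rightarrow> complex) \<Rightarrow> (nat \<Rightarrow> complex) \<Rightarrow> bool" where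
  "recurrence_coeffs P c lam \<longleftrightarrow>
     (\<forall>n. [:0, 1:] * P n = P (n + 1) + smult (c (n + 1)) (P n) + smult (lam (n + 1)) (prev P n)) \<and>
     (\<forall>n\<ge>1. lam n \<noteq> 0)"

(* (p(x) - p(a)) / (x - a); the division is exact. *)
definition diff_quot :: "complex poly \<Rightarrow> complex \<Rightarrow> complex poly" where
  "diff_quot p a = (p - [:poly p a:]) div [:-a, 1:]"

definition geronimus ::
  "(complex poly \<Rightarrow> complex) \<Rightarrow> complex \<Rightarrow> complex \<Rightarrow> complex poly \<Rightarrow> complex" where
  "geronimus L a M p = L (diff_quot p a) + M * poly p a"

(* numerator_prev L P n a is Q_{n-1}(a): the index is shifted by one, so that
   numerator_prev L P 0 a = Q_{-1}(a) = 0. *)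
definition numerator_prev ::
  "(complex poly \<Rightarrow> complex) \<Rightarrow> (nat \<Rightarrow> complex poly) \<Rightarrow> nat \<Rightarrow> complex \<Rightarrow> complex" where
  "numerator_prev L P n a = L (diff_quot (P n) a) / L 1"

(* For n >= 1 only. *)
definition geronimus_chi ::
  "(complex poly \<Rightarrow> complex) \<Rightarrow> (nat \<Rightarrow> complex poly) \<Rightarrow> complex \<Rightarrow> complex \<Rightarrow> nat \<Rightarrow> complex" where
  "geronimus_chi L P a M n =
     - ((L 1 * numerator_prev L P n a + M * poly (P n) a) /
        (L 1 * numerator_prev L P (n - 1) a + M * poly (P (n - 1)) a))"

definition quasi_geronimus ::
  "(nat \<Rightarrow> complex) \<Rightarrow> (nat \<Rightarrow> complex poly) \<Rightarrow> nat \<Rightarrow> complex poly" where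
  "quasi_geronimus beta G n = G n + smult (beta n) (prev G n)"

(* chi is indexed by the integers because the case n = 0 of the difference equation mentions chi_{-1}. *)

definition l_fun ::
  "(nat \<Rightarrow> complex) \<Rightarrow> (int \<Rightarrow> complex) \<Rightarrow> (nat \<Rightarrow> complex) \<Rightarrow> nat \<Rightarrow> complex \<Rightarrow> complex" where
  "l_fun c chi beta n x = x - c (n + 1) + chi (int n + 1) + beta (n + 1)"

definition d_fun ::
  "(nat \<Rightarrow> complex) \<Rightarrow> (nat \<Rightarrow> complex) \<Rightarrow> (int \<Rightarrow> complex) \<Rightarrow> (nat \<Rightarrow> complex) \<Rightarrow>
     nat \<Rightarrow> complex \<Rightarrow> complex" where
  "d_fun c lam chi beta n x =
     chi (int n) + beta n + (x - c n) * chi (int n - 1) * (beta n / lam n)"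

(* With G^Q the quasi-Geronimus polynomials, the recurrence turns the definition of G^Q_{n+1} into
     G^Q_{n+1} = l_n P_n - (lambda_{n+1} - chi_n beta_{n+1}) P_{n-1}.
   The source prints c_{n+1} + lambda_{n+1} - chi_n beta_{n+1} for the coefficient in brackets, here
   and in the difference equation. The summand c_{n+1} is a misprint: with it the difference equation
   fails, for instance for n = 1, beta = 0, a = -1, M = 1 and L[p] the integral of p(x) exp(-x)
   over (0, infinity). *)
definition j_fun ::
  "(nat \<Rightarrow> complex) \<Rightarrow> (nat \<Rightarrow> complex) \<Rightarrow> (int \<Rightarrow> complex) \<Rightarrow> (nat \<Rightarrow> complex) \<Rightarrow>
     nat \<Rightarrow> complex \<Rightarrow> complex" where
  "j_fun c lam chi beta n x =
     l_fun c chi beta n x * d_fun c lam chi beta n x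
     - (lam (n + 1) - chi (int n) * beta (n + 1)) * (chi (int n - 1) * (beta n / lam n) - 1)"

(* m_next ... n x is m_{n+1}(x). *)
definition m_next ::
  "(nat \<Rightarrow> complex) \<Rightarrow> (nat \<Rightarrow> complex) \<Rightarrow> (int \<Rightarrow> complex) \<Rightarrow> (nat \<Rightarrow> complex) \<Rightarrow>
     nat \<Rightarrow> complex \<Rightarrow> complex" where
  "m_next c lam chi beta n x =
     l_fun c chi beta (n + 1) x * (x - c (n + 1)) + beta (n + 2) * chi (int n + 1) - lam (n + 2)"

end

(* Since L[p] = L^G[(x - a) p], the polynomial G_n is L-orthogonal to all polynomials of degree
   below n - 1, so G_n = P_n + t P_{n-1}; the condition L^G[G_n] = 0 then forces t = chi_n. With the
   three-term recurrence, the polynomials G^Q_n, G^Q_{n+1}, G^Q_{n+2} are combinations of P_n and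
   P_{n-1} with coefficients that are polynomials in x, and the difference equation is the linear
   relation between three vectors of a plane (Cramer's rule). *)
theory Submission
  imports Defs
begin

lemma linear_functional_add: "linear_functional L \<Longrightarrow> L (p + q) = L p + L q"
  unfolding linear_functional_def Vector_Spaces.linear_def by (blast dest: module_hom.add)

lemma linear_functional_smult: "linear_functional L \<Longrightarrow> L (smult b p) = b * L p"
  unfolding linear_functional_def Vector_Spaces.linear_def by (blast dest: module_hom.scale)

lemma linear_functional_0: "linear_functional L \<Longrightarrow> L 0 = 0"
  using linear_functional_smult[of L 0 0] by simp

lemma linear_functional_diff: "linear_functional L \<Longrightarrow> L (p - q) = L p - L q"
  using linear_functional_add[of L "p - q" q] by simp

lemma monic_ops_coeff: "monic_ops L P \<Longrightarrow> coeff (P n) n = 1"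
  unfolding monic_ops_def by metis

lemma monic_ops_coeff_eq_0: "monic_ops L P \<Longrightarrow> n < i \<Longrightarrow> coeff (P n) i = 0"
  unfolding monic_ops_def by (simp add: coeff_eq_0)

lemma monic_ops_0:
  assumes P: "monic_ops L P"
  shows "P 0 = 1"
proof (rule poly_eqI)
  show "coeff (P 0) i = coeff 1 i" for i
    using monic_ops_coeff[OF P, of 0] monic_ops_coeff_eq_0[OF P, of 0 i] by (cases i) auto
qed

text \<open>Induction on the degree bound: subtracting \<open>coeff p m\<close> times the monic
  \<open>P m\<close> lowers it by one. Bounding coefficients instead of \<open>degree\<close> lets
  the base case be the zero polynomial.\<close>

lemma monic_ops_orthogonal:
  assumes L: "linear_functional L" and P: "monic_ops L P"
  shows "m \<le> n \<Longrightarrow> (\<And>i. m \<le> i \<Longrightarrow> coeff p i = 0) \<Longrightarrow> L (P n * p) = 0"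
proof (induction m arbitrary: p)
  case 0
  then have "p = 0" by (simp add: poly_eq_iff)
  then show ?case by (simp add: linear_functional_0[OF L])
next
  case (Suc m)
  define q where "q = p - smult (coeff p m) (P m)"
  have "coeff q i = 0" if "m \<le> i" for i
    using that Suc.prems(2)[of i] monic_ops_coeff[OF P, of m] monic_ops_coeff_eq_0[OF P, of m i]
    by (cases "i = m") (auto simp: q_def)
  with Suc have "L (P n * q) = 0" by simp
  moreover have "L (P n * P m) = 0"
    using P Suc.prems(1) unfolding monic_ops_def by simp
  moreover have "P n * p = P n * q + smult (coeff p m) (P n * P m)"
    by (simp add: q_def algebra_simps)
  ultimately show ?case
    by (simp add: linear_functional_add[OF L] linear_functional_smult[OF L])
qed

lemma monic_ops_pairing:
  assumes L: "linear_functional L" and P: "monic_ops L P"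
    and p: "\<And>i. n < i \<Longrightarrow> coeff p i = 0"
  shows "L (P n * p) = coeff p n * L ((P n)\<^sup>2)"
proof -
  define q where "q = p - smult (coeff p n) (P n)"
  have "coeff q i = 0" if "n \<le> i" for i
    using that p[of i] monic_ops_coeff[OF P, of n] monic_ops_coeff_eq_0[OF P, of n i]
    by (cases "i = n") (auto simp: q_def)
  then have "L (P n * q) = 0" by (rule monic_ops_orthogonal[OF L P order_refl])
  moreover have "P n * p = P n * q + smult (coeff p n) ((P n)\<^sup>2)"
    by (simp add: q_def algebra_simps power2_eq_square)
  ultimately show ?thesis
    by (simp add: linear_functional_add[OF L] linear_functional_smult[OF L])
qed

text \<open>Pairing a nonzero \<open>S\<close> with the \<open>P k\<close> of the same degree gives
  the leading coefficient of \<open>S\<close> times a nonzero norm. Used to identify two polynomials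
  by their pairings.\<close>

lemma monic_ops_eq_0I:
  assumes L: "linear_functional L" and P: "monic_ops L P"
    and S: "\<And>i. m \<le> i \<Longrightarrow> coeff S i = 0"
    and orth: "\<And>k. k < m \<Longrightarrow> L (P k * S) = 0"
  shows "S = 0"
proof (rule ccontr)
  assume "S \<noteq> 0"
  then have lc: "coeff S (degree S) \<noteq> 0" by simp
  then have "degree S < m" using S by (meson not_less)
  moreover have "L (P (degree S) * S) = coeff S (degree S) * L ((P (degree S))\<^sup>2)"
    by (rule monic_ops_pairing[OF L P]) (simp add: coeff_eq_0)
  moreover have "L ((P (degree S))\<^sup>2) \<noteq> 0" using P unfolding monic_ops_def by simp
  ultimately show False using lc orth by simp
qed

text \<open>The argument vanishes at \<open>a\<close>, so the term with \<open>M\<close> drops out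
  and the difference quotient is \<open>p\<close> itself. Orthogonality passes between the two
  functionals through this identity.\<close>

lemma geronimus_mult_linear: "geronimus L a M ([:-a, 1:] * p) = L p"
proof -
  have "diff_quot ([:-a, 1:] * p) a = ([:-a, 1:] * p) div [:-a, 1:]"
    by (simp add: diff_quot_def)
  also have "\<dots> = p" by (rule nonzero_mult_div_cancel_left) simp
  finally show ?thesis by (simp add: geronimus_def)
qed

text \<open>Up to the factor \<open>L 1\<close>, which cancels, these values are the denominators in
  \<open>geronimus_chi\<close>; no default value of division by zero enters there.\<close>

lemma geronimus_monic_ops_nonzero:
  assumes L: "linear_functional L" and LG: "linear_functional (geronimus L a M)"
    and P: "monic_ops L P" and G: "monic_ops (geronimus L a M) G"
  shows "geronimus L a M (P n) \<noteq> 0"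
proof
  assume 0: "geronimus L a M (P n) = 0"
  let ?q = "synthetic_div (G n) a"
  (* Write G_n = (x - a) q + G_n(a): then L^G[G_n P_n] = L[P_n q] + G_n(a) L^G[P_n] would vanish. *)
  have G_eq: "G n = [:-a, 1:] * ?q + [:poly (G n) a:]"
    using synthetic_div_correct'[of a "G n"] by simp
  have P_q: "L (P n * ?q) = 0"
  proof (rule monic_ops_orthogonal[OF L P order_refl])
    fix i assume "n \<le> i"
    show "coeff ?q i = 0"
    \<comment> \<open>For \<open>n = 0\<close> the quotient is zero, but the truncated degree
      \<open>n - 1\<close> would still allow a constant term.\<close>
    proof (cases "n = 0")
      case True
      then have "?q = 0" using monic_ops_0[OF G] by (simp add: synthetic_div_eq_0_iff)
      then show ?thesis by simp
    next
      case False
      moreover have "degree ?q = n - 1"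
        using G by (simp add: degree_synthetic_div monic_ops_def)
      ultimately show ?thesis using \<open>n \<le> i\<close> by (simp add: coeff_eq_0)
    qed
  qed
  have "G n * P n = [:-a, 1:] * (P n * ?q) + smult (poly (G n) a) (P n)"
    by (subst G_eq) (simp add: algebra_simps)
  then have "geronimus L a M (G n * P n) = 0"
    by (simp only: linear_functional_add[OF LG] linear_functional_smult[OF LG]
        geronimus_mult_linear P_q 0) simp
  \<comment> \<open>As \<open>P n\<close> is monic of degree \<open>n\<close>, the same value is the
    norm of \<open>G n\<close>, which is nonzero.\<close>
  moreover have "geronimus L a M (G n * P n) = coeff (P n) n * geronimus L a M ((G n)\<^sup>2)"
    by (rule monic_ops_pairing[OF LG G]) (simp add: monic_ops_coeff_eq_0[OF P])
  ultimately show False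
    using monic_ops_coeff[OF P, of n] G unfolding monic_ops_def by auto
qed

lemma geronimus_chi_eq:
  assumes L: "linear_functional L" and P: "monic_ops L P"
  shows "geronimus_chi L P a M n = - (geronimus L a M (P n) / geronimus L a M (P (n - 1)))"
proof -
  have "L 1 \<noteq> 0"
    using P monic_ops_0[OF P] unfolding monic_ops_def by (metis power_one)
  then show ?thesis by (simp add: geronimus_chi_def numerator_prev_def geronimus_def)
qed

lemma geronimus_polynomial_eq:
  assumes L: "linear_functional L" and LG: "linear_functional (geronimus L a M)"
    and P: "monic_ops L P" and G: "monic_ops (geronimus L a M) G"
  shows "G (Suc n) = P (Suc n) + smult (geronimus_chi L P a M (Suc n)) (P n)"
proof -
  \<comment> \<open>The leading terms cancel in the difference, and this \<open>t\<close> removes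
    the next coefficient, so that \<open>S\<close> has only coefficients of index below
    \<open>n\<close>.\<close>
  define t where "t = coeff (G (Suc n) - P (Suc n)) n"
  define S where "S = G (Suc n) - P (Suc n) - smult t (P n)"
  have "S = 0"
  proof (rule monic_ops_eq_0I[OF L P])
    fix i assume "n \<le> i"
    then consider "i = n" | "i = Suc n" | "Suc n < i" by linarith
    then show "coeff S i = 0"
      by cases (simp_all add: S_def t_def monic_ops_coeff[OF P] monic_ops_coeff[OF G]
          monic_ops_coeff_eq_0[OF P] monic_ops_coeff_eq_0[OF G])
  next
    fix k assume "k < n"
    \<comment> \<open>The test polynomial has degree \<open>k + 1\<close>, at most \<open>n\<close>;
      its linear factor turns the statement into one about \<open>L\<close>.\<close>
    have "geronimus L a M (G (Suc n) * ([:-a, 1:] * P k)) = 0"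
    proof (rule monic_ops_orthogonal[OF LG G order_refl])
      fix i assume "Suc n \<le> i"
      then obtain j where i: "i = Suc j" "n \<le> j" by (cases i) auto
      show "coeff ([:-a, 1:] * P k) i = 0"
        using i \<open>k < n\<close> by (simp add: monic_ops_coeff_eq_0[OF P])
    qed
    then have "L (P k * G (Suc n)) = 0"
      by (metis geronimus_mult_linear mult.commute mult.left_commute)
    moreover have "L (P k * P (Suc n)) = 0" "L (P k * P n) = 0"
      using P \<open>k < n\<close> unfolding monic_ops_def by simp_all
    ultimately show "L (P k * S) = 0"
      by (simp add: S_def algebra_simps linear_functional_diff[OF L]
          linear_functional_add[OF L] linear_functional_smult[OF L])
  qed
  then have eq: "G (Suc n) = P (Suc n) + smult t (P n)"
    by (simp add: S_def algebra_simps)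
  \<comment> \<open>Since \<open>G 0 = 1\<close>, this is a linear equation for
    \<open>t\<close>.\<close>
  have "geronimus L a M (G (Suc n) * G 0) = 0"
    using G unfolding monic_ops_def by blast
  then have "geronimus L a M (P (Suc n)) + t * geronimus L a M (P n) = 0"
    using eq by (simp add: monic_ops_0[OF G] linear_functional_add[OF LG] linear_functional_smult[OF LG])
  then have "t = geronimus_chi L P a M (Suc n)"
    using geronimus_monic_ops_nonzero[OF L LG P G, of n]
    by (simp add: geronimus_chi_eq[OF L P] field_simps eq_neg_iff_add_eq_0)
  with eq show ?thesis by simp
qed

text \<open>Up to a common sign, the three coefficients are the 2 by 2 minors of the coordinates of
  \<open>A\<close>, \<open>B\<close>, \<open>C\<close> with respect to \<open>p\<close> and
  \<open>q\<close>. Nothing is divided, so degenerate minors are harmless.\<close>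

lemma relation_of_three_in_plane:
  fixes A B C p q d e k l m s :: "'a::comm_ring_1"
  assumes "A = d * q - e * p" and "B = l * p - k * q" and "C = m * p - s * q"
  shows "(l * d - k * e) * C = (d * m - s * e) * B + (m * k - s * l) * A"
  unfolding assms by (simp add: algebra_simps)

theorem theorem3p1:
  fixes L :: "complex poly \<Rightarrow> complex"
    and a :: real
    and M :: complex
    and P G :: "nat \<Rightarrow> complex poly"
    and c lam beta :: "nat \<Rightarrow> complex"
    and chi :: "int \<Rightarrow> complex"
    and n :: nat
    and x :: complex
  assumes "quasi_definite L"
    and "quasi_definite (geronimus L (of_real a) M)"
    and "monic_ops L P"
    and "monic_ops (geronimus L (of_real a) M) G"
    and "recurrence_coeffs P c lam"
    and "\<And>k::nat. k \<ge> 1 \<Longrightarrow> chi (int k) = geronimus_chi L P (of_real a) M k"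
    and "chi (-1) = 0 \<or> beta 0 = 0"
  shows "j_fun c lam chi beta n x * poly (quasi_geronimus beta G (n + 2)) x =
      (d_fun c lam chi beta n x * m_next c lam chi beta n x
        - lam (n + 1) * l_fun c chi beta (n + 1) x * (chi (int n - 1) * (beta n / lam n) - 1))
        * poly (quasi_geronimus beta G (n + 1)) x
    + (m_next c lam chi beta n x * (lam (n + 1) - chi (int n) * beta (n + 1))
        - lam (n + 1) * l_fun c chi beta n x * l_fun c chi beta (n + 1) x)
        * poly (quasi_geronimus beta G n) x"
proof -
  have L: "linear_functional L" and LG: "linear_functional (geronimus L (of_real a) M)"
    using assms(1,2) unfolding quasi_definite_def by auto
  note P = assms(3) and G = assms(4)
  have G_Suc: "poly (G (Suc k)) x = poly (P (Suc k)) x + chi (int k + 1) * poly (P k) x" for k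
    using geronimus_polynomial_eq[OF L LG P G, of k] assms(6)[of "Suc k"] by (simp add: add.commute)
  have G_0: "G 0 = 1" and P_0: "P 0 = 1"
    using monic_ops_0 P G by auto
  have lam: "lam (Suc k) \<noteq> 0" for k
    using assms(5) unfolding recurrence_coeffs_def by simp
  have P_Suc: "poly (P (Suc k)) x = (x - c (Suc k)) * poly (P k) x - lam (Suc k) * poly (prev P k) x" for k
  proof -
    have "[:0, 1:] * P k = P (k + 1) + smult (c (k + 1)) (P k) + smult (lam (k + 1)) (prev P k)"
      using assms(5) unfolding recurrence_coeffs_def by blast
    then have "poly ([:0, 1:] * P k) x
        = poly (P (k + 1) + smult (c (k + 1)) (P k) + smult (lam (k + 1)) (prev P k)) x"
      by (rule arg_cong)
    then show ?thesis by (simp add: algebra_simps)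
  qed
  define p q where "p = poly (P n) x" and "q = poly (prev P n) x"
  define k where "k = lam (n + 1) - chi (int n) * beta (n + 1)"
  define e where "e = chi (int n - 1) * (beta n / lam n) - 1"
  define s where "s = lam (n + 1) * l_fun c chi beta (n + 1) x"
  \<comment> \<open>The recurrence eliminates \<open>P (Suc i)\<close>. The case
    \<open>i = 0\<close> is separate because \<open>G 0\<close> is not covered by
    \<open>G_Suc\<close>; there \<open>prev P 0 = 0\<close> removes \<open>chi 0\<close>.\<close>
  have step: "poly (quasi_geronimus beta G (Suc i)) x
      = l_fun c chi beta i x * poly (P i) x
        - (lam (Suc i) - chi (int i) * beta (Suc i)) * poly (prev P i) x" for i
  proof (cases i)
    case 0
    then show ?thesis
      by (simp add: quasi_geronimus_def prev_def G_Suc P_Suc G_0 P_0 l_fun_def algebra_simps)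
  next
    case (Suc j)
    then show ?thesis
      by (simp add: quasi_geronimus_def prev_def G_Suc P_Suc[of "Suc j"] l_fun_def algebra_simps)
  qed
  have A: "poly (quasi_geronimus beta G n) x = d_fun c lam chi beta n x * q - e * p"
  proof (cases n)
    case 0
    \<comment> \<open>The last hypothesis gives \<open>e = -1\<close>, whatever \<open>lam 0\<close>
      is; as \<open>q = 0\<close> and \<open>p = 1\<close>, both sides of the claim equal 1.\<close>
    then have "chi (int n - 1) * (beta n / lam n) = 0" using assms(7) by auto
    then show ?thesis using 0
      by (simp add: quasi_geronimus_def p_def q_def e_def prev_def G_0 P_0)
  next
    case (Suc i)
    have "poly (quasi_geronimus beta G (Suc i)) x
      = poly (P (Suc i)) x + (chi (int i + 1) + beta (Suc i)) * poly (P i) x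
        + chi (int i) * beta (Suc i) * poly (prev P i) x"
      unfolding step[of i] P_Suc[of i] by (simp add: l_fun_def algebra_simps)
    \<comment> \<open>To stay in the span of \<open>p\<close> and \<open>q\<close>, the entry of
      index \<open>n - 2\<close> is removed by reading the recurrence backwards. This costs a
      division by \<open>lam n\<close> and explains the quotient in \<open>d_fun\<close> and
      \<open>e\<close>.\<close>
    also have "chi (int i) * beta (Suc i) * poly (prev P i) x
      = chi (int i) * (beta (Suc i) / lam (Suc i)) * (lam (Suc i) * poly (prev P i) x)"
      using lam[of i] by simp
    also have "lam (Suc i) * poly (prev P i) x = (x - c (Suc i)) * poly (P i) x - poly (P (Suc i)) x"
      using P_Suc[of i] by simp
    finally show ?thesis using Suc
      by (simp add: p_def q_def e_def d_fun_def prev_def algebra_simps)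
  qed
  have B: "poly (quasi_geronimus beta G (n + 1)) x = l_fun c chi beta n x * p - k * q"
    using step[of n] by (simp add: p_def q_def k_def)
  \<comment> \<open>Here \<open>step\<close> at \<open>n + 1\<close> involves
    \<open>P (n + 1)\<close> and \<open>P n\<close>; the recurrence replaces the former by
    \<open>p\<close> and \<open>q\<close>.\<close>
  have C: "poly (quasi_geronimus beta G (n + 2)) x = m_next c lam chi beta n x * p - s * q"
    using step[of "Suc n"] P_Suc[of n]
    by (simp add: p_def q_def s_def m_next_def prev_def algebra_simps)
  show ?thesis
    using relation_of_three_in_plane[OF A B C]
    unfolding j_fun_def k_def e_def s_def
    by (simp only: mult.assoc mult.commute[of "l_fun c chi beta n x" "l_fun c chi beta (n + 1) x"])
qed

end
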